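(* Let $\epsilon>0$, $L>0$ and the integer $d\ge1$ be fixed. For each $D>d$, let $\mathcal{X}=[-1,1]^D$, let $f:\mathcal{X}\to\mathbb{R}$ be Lipschitz continuous with constant $L$ (with respect to the Euclidean norm), let $x^*$ be a global minimizer of $f$ over $\mathcal{X}$ with $B_{\epsilon/L}(x^* )\subset\mathcal{X}$, let $p\in\mathcal{X}\setminus G_\epsilon$, and let $r_p:=\epsilon/(L\|x^*-p\|)$. Let $\Delta_0=\sqrt{\frac{2D}{\pi e}}$. Then: a) If $\displaystyle\lim_{D\to\infty}\frac{\Delta_0}{\|x^*-p\|}=\psi>1$, then $\tau(r_p,d,D)/\tau_{us}\to\infty$ as $D\to\infty$. b) If $\displaystyle\lim_{D\to\infty}\frac{\Delta_0}{\|x^*-p\|}=\psi<1$, then $\tau(r_p,d,D)/\tau_{us}\to0$ as $D\to\infty$.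
   Context: $G_\epsilon:=\{x\in\mathcal{X}: f(x)\le f^*+\epsilon\}$ with $f^*:=\min_{x\in\mathcal{X}}f(x)$; $B_r(x)$ is the closed Euclidean ball of radius $r$ centred at $x$; $\|\cdot\|$ is the Euclidean norm. The objects $f,x^*,p$ may depend on $D$. For $0<r<1$ and integers $1\le d<D$, $$\tau(r,d,D):=\begin{cases}(D-1)\binom{\frac{D-2}{2}}{\frac{D-1}{2}}\displaystyle\int_0^{\arcsin(r)}\sin^{D-2}(x)\,dx & \text{if } d=1,\\[2mm] \binom{\frac{D-2}{2}}{\frac{D-d}{2}}\,r^{D-d}(1-r^2)^{\frac{d-2}{2}} & \text{if } 1<d<D,\end{cases}$$ where $\binom{i}{j}=\frac{\Gamma(i+1)}{\Gamma(j+1)\Gamma(i-j+1)}$ for real $i,j$. Further, $$\tau_{us}:=\frac{\mathrm{Vol}(B_{\epsilon/L}(x^* ))}{\mathrm{Vol}(\mathcal{X})}=\frac{\pi^{D/2}}{2^D\,\Gamma(\frac D2+1)}\left(\frac{\epsilon}{L}\right)^D$$ (a lower bound on the probability that a point sampled uniformly in $\mathcal{X}$ lies in $G_\epsilon$). The limit $\psi$ is a (finite) real number. *)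

theory Defs
  imports "HOL-Analysis.Analysis"
begin

text \<open>
  The dimension tends to infinity inside the theorem, so it cannot be a type.
  Euclidean space of dimension \<open>D\<close> is the set of extensional functions on
  \<open>{..<D}\<close> (which is the underlying set of the product measure space
  \<open>Pi\<^sub>M {..<D} (\<lambda>_. lborel)\<close>), with the Euclidean distance given explicitly.
\<close>

definition edist :: "nat \<Rightarrow> (nat \<Rightarrow> real) \<Rightarrow> (nat \<Rightarrow> real) \<Rightarrow> real" where
  "edist D x y = L2_set (\<lambda>i. x i - y i) {..<D}"

definition euclid_cball :: "nat \<Rightarrow> real \<Rightarrow> (nat \<Rightarrow> real) \<Rightarrow> (nat \<Rightarrow> real) set" where
  "euclid_cball D r x = {y \<in> {..<D} \<rightarrow>\<^sub>E UNIV. edist D x y \<le> r}"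

definition cube :: "nat \<Rightarrow> (nat \<Rightarrow> real) set" where
  "cube D = {..<D} \<rightarrow>\<^sub>E {-1..1}"

definition Vol :: "nat \<Rightarrow> (nat \<Rightarrow> real) set \<Rightarrow> real" where
  "Vol D A = measure (Pi\<^sub>M {..<D} (\<lambda>_. lborel)) A"

text \<open>The infimum is a minimum whenever it is used: the theorem provides a global minimizer.\<close>

definition min_val :: "nat \<Rightarrow> ((nat \<Rightarrow> real) \<Rightarrow> real) \<Rightarrow> real" where
  "min_val D f = (INF x\<in>cube D. f x)"

definition near_opt :: "nat \<Rightarrow> ((nat \<Rightarrow> real) \<Rightarrow> real) \<Rightarrow> real \<Rightarrow> (nat \<Rightarrow> real) set" where
  "near_opt D f \<epsilon> = {x \<in> cube D. f x \<le> min_val D f + \<epsilon>}"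

text \<open>Binomial coefficients with two real arguments; the library's \<open>gchoose\<close> only allows a
  natural number as its lower argument.\<close>

definition rbinom :: "real \<Rightarrow> real \<Rightarrow> real" where
  "rbinom i j = Gamma (i + 1) / (Gamma (j + 1) * Gamma (i - j + 1))"

text \<open>Only meaningful for \<open>0 < r < 1\<close> and \<open>1 \<le> d < D\<close>; in particular the natural-number
  subtractions in the exponents are then exact, and the base of \<open>powr\<close> is positive.\<close>

definition \<tau> :: "real \<Rightarrow> nat \<Rightarrow> nat \<Rightarrow> real" where
  "\<tau> r d D =
    (if d = 1 then
       (real D - 1) * rbinom ((real D - 2) / 2) ((real D - 1) / 2)
         * integral {0..arcsin r} (\<lambda>x. sin x ^ (D - 2))
     else
       rbinom ((real D - 2) / 2) ((real D - real d) / 2)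
         * r ^ (D - d) * (1 - r\<^sup>2) powr ((real d - 2) / 2))"

definition \<tau>_us :: "nat \<Rightarrow> real \<Rightarrow> real \<Rightarrow> (nat \<Rightarrow> real) \<Rightarrow> real" where
  "\<tau>_us D \<epsilon> L x = Vol D (euclid_cball D (\<epsilon> / L) x) / Vol D (cube D)"

definition \<Delta>\<^sub>0 :: "nat \<Rightarrow> real" where
  "\<Delta>\<^sub>0 D = sqrt (2 * real D / (pi * exp 1))"

lemma space_PiM_lborel:
  fixes D :: nat
  shows "space (Pi\<^sub>M {..<D} (\<lambda>_. lborel :: real measure)) = {..<D} \<rightarrow>\<^sub>E UNIV"
  by (simp add: space_PiM)

lemma Vol_cube: "Vol D (cube D) = 2 ^ D"
proof -
  interpret product_sigma_finite "\<lambda>_::nat. lborel :: real measure"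
    by (simp add: product_sigma_finite.intro sigma_finite_lborel)
  have "emeasure (Pi\<^sub>M {..<D} (\<lambda>_. lborel)) (cube D) = ennreal (2 ^ D)"
    unfolding cube_def by (subst emeasure_PiM) (auto simp: ennreal_power simp flip: ennreal_numeral)
  thus ?thesis
    unfolding Vol_def measure_def by simp
qed

lemma distr_PiM_lborel_shift:
  fixes D :: nat and c :: "nat \<Rightarrow> real"
  shows "distr (Pi\<^sub>M {..<D} (\<lambda>_. lborel)) (Pi\<^sub>M {..<D} (\<lambda>_. lborel :: real measure))
     (\<lambda>y. \<lambda>i\<in>{..<D}. c i + y i) = Pi\<^sub>M {..<D} (\<lambda>_. lborel)"
  (is "distr ?M ?M ?T = _")
proof -
  interpret product_sigma_finite "\<lambda>_::nat. lborel :: real measure"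
    by (simp add: product_sigma_finite.intro sigma_finite_lborel)
  have T: "?T \<in> measurable ?M ?M"
    by (intro measurable_restrict) measurable
  show ?thesis
  proof (rule PiM_eqI)
    fix A :: "nat \<Rightarrow> real set"
    assume A: "\<And>i. i \<in> {..<D} \<Longrightarrow> A i \<in> sets lborel"
    have A': "(+) (c i) -` A i \<in> sets lborel" if "i < D" for i
      using measurable_sets[of "(+) (c i)" lborel borel "A i"] A that by auto
    have "emeasure (distr ?M ?M ?T) (Pi\<^sub>E {..<D} A) = emeasure ?M (?T -` Pi\<^sub>E {..<D} A \<inter> space ?M)"
      using A T by (intro emeasure_distr) auto
    also have "?T -` Pi\<^sub>E {..<D} A \<inter> space ?M = Pi\<^sub>E {..<D} (\<lambda>i. (+) (c i) -` A i)"
      by (auto simp: space_PiM_lborel PiE_iff)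
    also have "emeasure ?M \<dots> = (\<Prod>i<D. emeasure lborel ((+) (c i) -` A i))"
      using A' by (intro emeasure_PiM) auto
    also have "\<dots> = (\<Prod>i<D. emeasure lborel (A i))"
    proof (rule prod.cong)
      fix i assume "i \<in> {..<D}"
      hence "emeasure (distr lborel borel ((+) (c i))) (A i) = emeasure lborel ((+) (c i) -` A i)"
        using A[of i] by (subst emeasure_distr) auto
      thus "emeasure lborel ((+) (c i) -` A i) = emeasure lborel (A i)"
        by (simp add: lborel_distr_plus)
    qed auto
    finally show "emeasure (distr ?M ?M ?T) (Pi\<^sub>E {..<D} A) = (\<Prod>i<D. emeasure lborel (A i))" .
  qed auto
qed

lemma Vol_euclid_cball:
  assumes "r > 0"
  shows "Vol D (euclid_cball D r x) = unit_ball_vol (real D) * r ^ D"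
proof -
  let ?M = "Pi\<^sub>M {..<D} (\<lambda>_. lborel :: real measure)"
  let ?T = "\<lambda>y. \<lambda>i\<in>{..<D}. x i + y i"
  have T: "?T \<in> measurable ?M ?M"
    by (intro measurable_restrict) measurable
  have "(\<lambda>y. sqrt (\<Sum>i<D. (x i - y i)\<^sup>2)) \<in> borel_measurable ?M"
    by measurable
  hence "{y \<in> space ?M. sqrt (\<Sum>i<D. (x i - y i)\<^sup>2) \<le> r} \<in> sets ?M"
    by measurable
  hence meas: "euclid_cball D r x \<in> sets ?M"
    by (simp add: euclid_cball_def edist_def L2_set_def space_PiM_lborel)
  have "emeasure ?M (euclid_cball D r x) = emeasure (distr ?M ?M ?T) (euclid_cball D r x)"
    by (simp add: distr_PiM_lborel_shift)
  also have "\<dots> = emeasure ?M (?T -` euclid_cball D r x \<inter> space ?M)"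
    by (rule emeasure_distr[OF T meas])
  also have "?T -` euclid_cball D r x \<inter> space ?M = {y. sqrt (\<Sum>i<D. (y i)\<^sup>2) \<le> r} \<inter> space ?M"
    by (auto simp: euclid_cball_def edist_def L2_set_def)
  also have "emeasure ?M \<dots> = ennreal (unit_ball_vol (real D) * r ^ D)"
    using emeasure_cball_aux[of "{..<D}" r] assms by simp
  finally show ?thesis
    using assms by (simp add: Vol_def measure_def)
qed

lemma \<tau>_us_eq:
  assumes "\<epsilon> > 0" "L > 0"
  shows "\<tau>_us D \<epsilon> L x = pi powr (real D / 2) / (2 ^ D * Gamma (real D / 2 + 1)) * (\<epsilon> / L) ^ D"
  using assms by (simp add: \<tau>_us_def Vol_euclid_cball Vol_cube unit_ball_vol_def)

end

theory Submission
  imports Defs "HOL-Real_Asymp.Real_Asymp"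
begin

text \<open>
  Write \<open>c = \<epsilon> / L\<close> and \<open>\<rho> = \<Delta>\<^sub>0 / \<parallel>x\<^sup>* - p\<parallel>\<close>, so that \<open>r = c \<rho> / \<Delta>\<^sub>0\<close>; the Lipschitz bound gives
  \<open>r < 1\<close>, and \<open>r \<rightarrow> 0\<close> because \<open>\<Delta>\<^sub>0 \<rightarrow> \<infinity>\<close>. Up to a factor that tends to 1, \<open>\<tau>\<close> is
  \<open>\<Gamma>(D/2) / (\<Gamma>((D-d)/2+1) \<Gamma>(d/2)) r\<^sup>D\<^sup>-\<^sup>d\<close> (for \<open>d = 1\<close> by comparing \<open>sin\<^sup>D\<^sup>-\<^sup>2\<close> with
  \<open>sin\<^sup>D\<^sup>-\<^sup>2 cos\<close>). The number \<open>\<Delta>\<^sub>0\<close> is, up to a polynomial factor, the \<open>D\<close>-th root of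
  \<open>2\<^sup>D \<Gamma>(D/2+1) / \<pi>\<^sup>D\<^sup>/\<^sup>2\<close>, as in Stirling's formula. Hence \<open>\<tau> / \<tau>\<^sub>u\<^sub>s\<close> lies between two powers of \<open>D\<close> times
  \<open>\<rho>\<^sup>D\<^sup>-\<^sup>d\<close>, and the geometric factor decides. The polynomial bounds on quotients of Gamma values
  need only the functional equation, in the form of monotonicity along steps of length two in \<open>D\<close>.
\<close>

section \<open>Sequences that are monotone along steps of length two\<close>

lemma pos_not_nonpos_Ints: "x > 0 \<Longrightarrow> (x :: real) \<notin> \<int>\<^sub>\<le>\<^sub>0"
  by (auto elim!: nonpos_Ints_cases)

text \<open>Descending from \<open>n\<close> by twos ends at \<open>N\<close> or at
  \<open>N + 1\<close>, according to parity; hence two starting values compete in the minimum. Steps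
  of two fit Gamma at \<open>D / 2\<close>, whose argument then moves by exactly one.\<close>

lemma two_step_mono_lower_bound:
  fixes u :: "nat \<Rightarrow> real"
  assumes "\<And>n. n \<ge> N \<Longrightarrow> u n \<le> u (n + 2)" and "n \<ge> N"
  shows "min (u N) (u (N + 1)) \<le> u n"
  using assms(2)
proof (induction n rule: less_induct)
  case (less n)
  show ?case
  proof (cases "n \<ge> N + 2")
    case True
    have "min (u N) (u (N + 1)) \<le> u (n - 2)"
      using True by (intro less.IH) auto
    also have "\<dots> \<le> u (n - 2 + 2)"
      using True by (intro assms(1)) auto
    also have "n - 2 + 2 = n"
      using True by (intro le_add_diff_inverse2) auto
    finally show ?thesis .
  next
    case False
    hence "n = N \<or> n = N + 1" using less.prems by auto
    thus ?thesis by auto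
  qed
qed

lemma two_step_mono_ex_pos_lower_bound:
  fixes u :: "nat \<Rightarrow> real"
  assumes "\<And>n. n \<ge> N \<Longrightarrow> u n \<le> u (n + 2)" and "\<And>n. n \<ge> N \<Longrightarrow> u n > 0"
  shows "\<exists>m>0. \<forall>n\<ge>N. m \<le> u n"
  using two_step_mono_lower_bound[of N u] assms
  by (intro exI[of _ "min (u N) (u (N + 1))"]) auto

lemma two_step_antimono_ex_upper_bound:
  fixes u :: "nat \<Rightarrow> real"
  assumes "\<And>n. n \<ge> N \<Longrightarrow> u (n + 2) \<le> u n"
  shows "\<exists>M>0. \<forall>n\<ge>N. u n \<le> M"
proof -
  \<comment> \<open>The lower bound is applied to the negated sequence; the 1 only makes the bound
    positive.\<close>
  have "u n \<le> max 1 (max (u N) (u (N + 1)))" if "n \<ge> N" for n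
    using two_step_mono_lower_bound[of N "\<lambda>n. - u n" n] assms that by auto
  thus ?thesis by (intro exI[of _ "max 1 (max (u N) (u (N + 1)))"]) auto
qed

section \<open>\<open>\<Delta>\<^sub>0\<close> and its relation to Stirling's formula\<close>

lemma \<Delta>\<^sub>0_eq: "\<Delta>\<^sub>0 D = \<Delta>\<^sub>0 1 * sqrt (real D)"
  by (simp add: \<Delta>\<^sub>0_def flip: real_sqrt_mult)

lemma \<Delta>\<^sub>0_pos: "D > 0 \<Longrightarrow> \<Delta>\<^sub>0 D > 0"
  by (simp add: \<Delta>\<^sub>0_def)

lemma \<Delta>\<^sub>0_at_top: "filterlim \<Delta>\<^sub>0 at_top sequentially"
  unfolding \<Delta>\<^sub>0_def by real_asymp

text \<open>With c = \<epsilon> / L this is (c / \<open>\<Delta>\<^sub>0 D\<close>)^D /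
  \<open>\<tau>_us\<close>, in which c cancels. By Stirling's formula it grows like sqrt (pi * D);
  polynomial bounds are enough here.\<close>

definition stirling_ratio :: "nat \<Rightarrow> real" where
  "stirling_ratio D = Gamma (real D / 2 + 1) * (2 / (sqrt pi * \<Delta>\<^sub>0 D)) ^ D"

lemma stirling_ratio_pos: "D > 0 \<Longrightarrow> stirling_ratio D > 0"
  by (simp add: stirling_ratio_def \<Delta>\<^sub>0_pos Gamma_real_pos)

lemma stirling_ratio_step:
  assumes "D > 0"
  shows "stirling_ratio (D + 2) = stirling_ratio D * (exp 1 * sqrt (real D / real (D + 2)) ^ D)"
proof -
  have G: "Gamma (real (D + 2) / 2 + 1) = (real D / 2 + 1) * Gamma (real D / 2 + 1)"
    using Gamma_plus1[OF pos_not_nonpos_Ints, of "real D / 2 + 1"] by (simp add: add_divide_distrib add_ac)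
  \<comment> \<open>Two of the D + 2 factors of the power give 2e / (D + 2), which the new Gamma
    factor D / 2 + 1 reduces to e. The other D factors are compared with those of
    \<open>stirling_ratio D\<close> in \<open>quot\<close>.\<close>
  have sq: "(2 / (sqrt pi * \<Delta>\<^sub>0 (D + 2)))\<^sup>2 * (real D / 2 + 1) = exp 1"
  proof -
    have "(2 / (sqrt pi * \<Delta>\<^sub>0 (D + 2)))\<^sup>2 = 4 / (2 * (real D + 2) / exp 1)"
      by (simp add: \<Delta>\<^sub>0_def power_divide power_mult_distrib)
    moreover have "4 / (2 * (real D + 2) / exp 1) * (real D / 2 + 1) = exp 1"
      by (simp add: divide_simps)
    ultimately show ?thesis by simp
  qed
  have quot: "2 / (sqrt pi * \<Delta>\<^sub>0 (D + 2)) = 2 / (sqrt pi * \<Delta>\<^sub>0 D) * sqrt (real D / real (D + 2))"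
    using assms unfolding \<Delta>\<^sub>0_eq[of D] \<Delta>\<^sub>0_eq[of "D + 2"] by (simp add: real_sqrt_divide)
  have "stirling_ratio (D + 2) = Gamma (real D / 2 + 1) *
      ((2 / (sqrt pi * \<Delta>\<^sub>0 (D + 2)))\<^sup>2 * (real D / 2 + 1)) * (2 / (sqrt pi * \<Delta>\<^sub>0 (D + 2))) ^ D"
    unfolding stirling_ratio_def G power_add by (simp only: mult_ac)
  also have "\<dots> = Gamma (real D / 2 + 1) * exp 1 *
      ((2 / (sqrt pi * \<Delta>\<^sub>0 D)) * sqrt (real D / real (D + 2))) ^ D"
    unfolding sq unfolding quot ..
  also have "\<dots> = stirling_ratio D * (exp 1 * sqrt (real D / real (D + 2)) ^ D)"
    unfolding stirling_ratio_def power_mult_distrib by (simp only: mult_ac)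
  finally show ?thesis .
qed

text \<open>Both bounds come from 1 + x \<le> exp x, at x = 2 / D and at x = -2 / (D + 2). The first
  makes \<open>stirling_ratio D\<close> nondecreasing along steps of two, the second makes
  \<open>stirling_ratio D / D\<close> nonincreasing.\<close>

lemma stirling_step_bounds:
  fixes D :: nat
  assumes "D > 0"
  shows "1 \<le> exp 1 * sqrt (real D / real (D + 2)) ^ D"
    and "exp 1 * sqrt (real D / real (D + 2)) ^ D \<le> real (D + 2) / real D"
proof -
  let ?q = "real D / real (D + 2)"
  have sqrt_exp: "sqrt (exp x) = exp (x / 2)" for x :: real
    by (rule real_sqrt_unique) (simp_all flip: exp_double)
  have "real (D + 2) / real D \<le> exp (2 / real D)"
    using exp_ge_add_one_self[of "2 / real D"] assms by (simp add: add_divide_distrib add_ac)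
  hence "exp (- (2 / real D)) \<le> ?q"
    using assms by (simp add: exp_minus field_simps)
  hence "sqrt (exp (- (2 / real D))) ^ D \<le> sqrt ?q ^ D"
    by (intro power_mono) auto
  also have "sqrt (exp (- (2 / real D))) ^ D = exp (- 1)"
    using assms by (simp add: sqrt_exp flip: exp_of_nat_mult)
  finally show "1 \<le> exp 1 * sqrt ?q ^ D"
    by (simp add: exp_minus field_simps)
next
  let ?q = "real D / real (D + 2)"
  have sqrt_exp: "sqrt (exp x) = exp (x / 2)" for x :: real
    by (rule real_sqrt_unique) (simp_all flip: exp_double)
  have q: "?q \<le> exp (- (2 / real (D + 2)))"
    using exp_ge_add_one_self[of "- (2 / real (D + 2))"] by (simp add: field_simps)
  hence "sqrt ?q ^ D \<le> sqrt (exp (- (2 / real (D + 2)))) ^ D"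
    by (intro power_mono) auto
  also have "\<dots> = exp (real D * (- (1 / real (D + 2))))"
  proof -
    have "- (2 / real (D + 2)) / 2 = - (1 / real (D + 2))" by (simp add: divide_simps)
    thus ?thesis unfolding exp_of_nat_mult sqrt_exp by (simp only:)
  qed
  also have "real D * (- (1 / real (D + 2))) = 2 / real (D + 2) - 1"
    by (simp add: field_simps)
  finally have "exp 1 * sqrt ?q ^ D \<le> exp 1 * exp (2 / real (D + 2) - 1)"
    by simp
  \<comment> \<open>The surplus exp (2 / (D + 2)) is bounded by a second use of \<open>q\<close>,
    now inverted, so that the bound telescopes.\<close>
  also have "\<dots> = inverse (exp (- (2 / real (D + 2))))"
    by (simp add: exp_minus flip: exp_add)
  also have "\<dots> \<le> inverse ?q"
    using q assms by (intro le_imp_inverse_le) auto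
  finally show "exp 1 * sqrt ?q ^ D \<le> real (D + 2) / real D"
    by simp
qed

section \<open>The binomial factor of \<open>\<tau>\<close> and polynomial bounds on its product
  with \<open>stirling_ratio\<close>\<close>

definition tau_coeff :: "nat \<Rightarrow> nat \<Rightarrow> real" where
  "tau_coeff d D = rbinom ((real D - 2) / 2) ((real D - real d) / 2)"

lemma tau_coeff_eq:
  "tau_coeff d D = Gamma (real D / 2) / (Gamma ((real D - real d) / 2 + 1) * Gamma (real d / 2))"
proof -
  have "(real D - 2) / 2 + 1 = real D / 2"
    "(real D - 2) / 2 - (real D - real d) / 2 + 1 = real d / 2" by (simp_all add: field_simps)
  thus ?thesis by (simp only: tau_coeff_def rbinom_def)
qed

lemma tau_coeff_pos: "1 \<le> d \<Longrightarrow> d < D \<Longrightarrow> tau_coeff d D > 0"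
  unfolding tau_coeff_eq by (intro divide_pos_pos mult_pos_pos Gamma_real_pos add_pos_pos) auto

text \<open>The functional equation acts once on each of the two Gamma values that depend on D, and
  the step factor is the quotient of the two arguments.\<close>

lemma tau_coeff_step:
  assumes "1 \<le> d" "d < D"
  shows "tau_coeff d (D + 2) = tau_coeff d D * (real D / (real D - real d + 2))"
proof -
  have "Gamma (real (D + 2) / 2) = real D / 2 * Gamma (real D / 2)"
    using Gamma_plus1[OF pos_not_nonpos_Ints, of "real D / 2"] assms
    by (simp add: add_divide_distrib add_ac)
  moreover have "Gamma ((real (D + 2) - real d) / 2 + 1) =
      ((real D - real d) / 2 + 1) * Gamma ((real D - real d) / 2 + 1)"
  proof -
    have "(real D - real d) / 2 + 1 > 0" using assms by (intro add_pos_pos) auto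
    from Gamma_plus1[OF pos_not_nonpos_Ints[OF this]] show ?thesis
      by (simp add: add_divide_distrib diff_divide_distrib add_ac diff_add_eq)
  qed
  moreover have "a / 2 * G / ((b / 2 + 1) * H * K) = G / (H * K) * (a / (b + 2))" for a b G H K :: real
    by (simp add: divide_simps)
  ultimately show ?thesis
    unfolding tau_coeff_eq by (simp only:)
qed

text \<open>The step factor D / (D - d + 2) of \<open>tau_coeff\<close> is below 1 for d = 1.
  Weighting by D - d turns it into D / (D - d) \<ge> 1, so the weighted product is nondecreasing
  along steps of two; its weight is at most D.\<close>

lemma polynomial_lower_bound:
  assumes "1 \<le> d"
  shows "\<exists>m>0. \<forall>D>d. m / real D \<le> tau_coeff d D * stirling_ratio D"
proof -
  let ?u = "\<lambda>D. (real D - real d) * tau_coeff d D * stirling_ratio D"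
  have "\<exists>m>0. \<forall>D\<ge>Suc d. m \<le> ?u D"
  proof (rule two_step_mono_ex_pos_lower_bound)
    fix D assume D: "D \<ge> Suc d"
    show "?u D > 0" using D assms by (simp add: tau_coeff_pos stirling_ratio_pos)
    have "(real D - real d) * tau_coeff d D \<le> real D * tau_coeff d D"
      using tau_coeff_pos[of d D] D assms by (intro mult_right_mono) auto
    also have "\<dots> = (real (D + 2) - real d) * tau_coeff d (D + 2)"
    proof -
      have "real (D + 2) - real d = real D - real d + 2" "real D - real d + 2 \<noteq> 0"
        using D by auto
      moreover have "tau_coeff d (D + 2) = tau_coeff d D * (real D / (real D - real d + 2))"
        using D assms by (intro tau_coeff_step) auto
      ultimately show ?thesis by (simp only: times_divide_eq_right nonzero_mult_div_cancel_left) (simp add: mult_ac)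
    qed
    finally have *: "(real D - real d) * tau_coeff d D \<le> \<dots>" .
    have "stirling_ratio D * 1 \<le> stirling_ratio D * (exp 1 * sqrt (real D / real (D + 2)) ^ D)"
      using stirling_ratio_pos[of D] stirling_step_bounds(1)[of D] D by (intro mult_left_mono) auto
    hence "stirling_ratio D \<le> stirling_ratio (D + 2)"
      using D stirling_ratio_step[of D] by simp
    show "?u D \<le> ?u (D + 2)"
      by (rule mult_mono[OF * \<open>stirling_ratio D \<le> stirling_ratio (D + 2)\<close>])
        (use D assms stirling_ratio_pos[of D] tau_coeff_pos[of d "D + 2"] in auto)
  qed
  then obtain m where m: "m > 0" "\<And>D. D > d \<Longrightarrow> m \<le> ?u D" by (auto simp: Suc_le_eq)
  have "m / real D \<le> tau_coeff d D * stirling_ratio D" if D: "D > d" for D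
  proof -
    have "m \<le> (real D - real d) * (tau_coeff d D * stirling_ratio D)"
      using m(2)[OF D] by (simp add: mult.assoc)
    also have "\<dots> \<le> real D * (tau_coeff d D * stirling_ratio D)"
      using D assms tau_coeff_pos[of d D] stirling_ratio_pos[of D] by (intro mult_right_mono) auto
    finally show ?thesis using D by (simp add: field_simps)
  qed
  with m(1) show ?thesis by blast
qed

text \<open>With z = D - d, Bernoulli's inequality bounds the step factor of
  \<open>tau_coeff\<close> by ((z + 2) / z)^d, so division by z^d makes \<open>tau_coeff\<close>
  nonincreasing along steps of two. Division by D does the same for \<open>stirling_ratio\<close>.
  The exponent d + 1 is generous.\<close>

lemma polynomial_upper_bound:
  assumes "1 \<le> d"
  shows "\<exists>M>0. \<forall>D>d. tau_coeff d D * stirling_ratio D \<le> M * real D ^ (d + 1)"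
proof -
  let ?u = "\<lambda>D. (tau_coeff d D / (real D - real d) ^ d) * (stirling_ratio D / real D)"
  have "\<exists>M>0. \<forall>D\<ge>Suc d. ?u D \<le> M"
  proof (rule two_step_antimono_ex_upper_bound)
    fix D assume D: "D \<ge> Suc d"
    define z where "z = real D - real d"
    have z: "z > 0" using D by (simp add: z_def)
    have "real D / (z + 2) \<le> 1 + real d * (2 / z)"
    proof -
      have "(z + real d) * z \<le> (z + real d * 2) * (z + 2)" using z by (intro mult_mono) auto
      hence "(z + real d) / (z + 2) \<le> (z + real d * 2) / z" using z by (simp add: divide_le_eq pos_le_divide_eq field_simps)
      moreover have "real D = z + real d" by (simp add: z_def)
      moreover have "1 + real d * (2 / z) = (z + real d * 2) / z" using z by (simp add: field_simps)
      ultimately show ?thesis by (simp only:)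
    qed
    also have "\<dots> \<le> (1 + 2 / z) ^ d"
      using z by (intro Bernoulli_inequality) (auto simp: field_simps)
    also have "\<dots> = (z + 2) ^ d / z ^ d"
      using z by (simp add: field_simps flip: power_divide)
    finally have q: "real D / (z + 2) \<le> (z + 2) ^ d / z ^ d" .
    have "tau_coeff d (D + 2) = tau_coeff d D * (real D / (z + 2))"
      unfolding z_def using D assms by (intro tau_coeff_step) auto
    also have "\<dots> \<le> tau_coeff d D * ((z + 2) ^ d / z ^ d)"
      using q tau_coeff_pos[of d D] D assms by (intro mult_left_mono) auto
    finally have "tau_coeff d (D + 2) / (z + 2) ^ d \<le> tau_coeff d D / z ^ d"
      using z by (simp add: field_simps)
    moreover have "real (D + 2) - real d = z + 2" by (simp add: z_def)
    ultimately have 1: "tau_coeff d (D + 2) / (real (D + 2) - real d) ^ d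
        \<le> tau_coeff d D / (real D - real d) ^ d"
      by (simp only: z_def)
    have "stirling_ratio (D + 2) \<le> stirling_ratio D * (real (D + 2) / real D)"
      using D by (subst stirling_ratio_step)
        (auto intro!: mult_left_mono stirling_step_bounds(2) less_imp_le[OF stirling_ratio_pos]
              simp del: of_nat_add add_2_eq_Suc' times_divide_eq_right)
    hence 2: "stirling_ratio (D + 2) / real (D + 2) \<le> stirling_ratio D / real D"
      using D by (simp add: field_simps)
    show "?u (D + 2) \<le> ?u D"
      using 1 2 D assms tau_coeff_pos[of d D] stirling_ratio_pos[of "D + 2"]
      by (intro mult_mono) auto
  qed
  then obtain M where M: "M > 0" "\<And>D. D > d \<Longrightarrow> ?u D \<le> M" by (auto simp: Suc_le_eq)
  have "tau_coeff d D * stirling_ratio D \<le> M * real D ^ (d + 1)" if D: "D > d" for D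
  proof -
    have "tau_coeff d D * stirling_ratio D = ?u D * ((real D - real d) ^ d * real D)"
      using D by simp
    also have "\<dots> \<le> M * (real D ^ d * real D)"
      using D M assms by (intro mult_mono power_mono) auto
    finally show ?thesis by (simp add: mult_ac)
  qed
  with M(1) show ?thesis by blast
qed

section \<open>Bounds on \<open>\<tau>\<close>, its quotient by \<open>\<tau>_us\<close>, and the
  bound on the radius\<close>

lemma integral_sin_power_bounds:
  assumes "0 < r" "r < 1"
  shows "r ^ Suc n \<le> real (Suc n) * integral {0..arcsin r} (\<lambda>x. sin x ^ n)"
    and "real (Suc n) * integral {0..arcsin r} (\<lambda>x. sin x ^ n) \<le> r ^ Suc n / sqrt (1 - r\<^sup>2)"
proof -
  define a where "a = arcsin r"
  have sina: "sin a = r" and cosa: "cos a = sqrt (1 - r\<^sup>2)"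
    using assms by (simp_all add: a_def cos_arcsin)
  have a: "0 < a" "a < pi / 2"
    using assms arcsin_lt_bounded[of r] arcsin_less_arcsin[of 0 r] by (auto simp: a_def)
  have cospos: "cos a > 0" using a by (intro cos_gt_zero) auto
  \<comment> \<open>With the extra factor cos the integrand has an explicit antiderivative. On
    {0..a} this factor lies between cos a and 1, which yields the two bounds.\<close>
  have "((\<lambda>x. sin x ^ Suc n / real (Suc n)) has_real_derivative sin x ^ n * cos x) (at x within {0..a})" for x
  proof -
    have "((\<lambda>x. sin x ^ Suc n) has_real_derivative (1 + of_nat n) * (cos x * sin x ^ n)) (at x within {0..a})"
      by (rule DERIV_power_Suc[OF has_field_derivative_at_within[OF DERIV_sin]])
    from DERIV_cdivide[OF this, of "real (Suc n)"] show ?thesis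
      by (simp add: mult_ac del: power_Suc)
  qed
  hence "((\<lambda>x. sin x ^ n * cos x) has_integral (sin a ^ Suc n / real (Suc n) - sin 0 ^ Suc n / real (Suc n))) {0..a}"
    using a by (intro fundamental_theorem_of_calculus)
      (auto simp del: of_nat_Suc power_Suc simp flip: has_real_derivative_iff_has_vector_derivative)
  hence I: "((\<lambda>x. sin x ^ n * cos x) has_integral (r ^ Suc n / real (Suc n))) {0..a}"
    by (simp add: sina)
  have int: "(\<lambda>x. sin x ^ n) integrable_on {0..a}"
    by (intro integrable_continuous_real continuous_intros)
  have sin_nonneg: "sin x \<ge> 0" if "x \<in> {0..a}" for x
    using that a by (intro sin_ge_zero) auto
  have "r ^ Suc n / real (Suc n) \<le> integral {0..a} (\<lambda>x. sin x ^ n)"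
    by (rule has_integral_le[OF I integrable_integral[OF int]])
      (use sin_nonneg in \<open>auto intro!: mult_left_le\<close>)
  thus "r ^ Suc n \<le> real (Suc n) * integral {0..arcsin r} (\<lambda>x. sin x ^ n)"
    by (simp add: a_def field_simps)
  have "integral {0..a} (\<lambda>x. sin x ^ n) \<le> r ^ Suc n / real (Suc n) / cos a"
  proof (rule has_integral_le[OF integrable_integral[OF int] has_integral_divide[OF I]])
    fix x assume x: "x \<in> {0..a}"
    have "cos a \<le> cos x" using x a by (intro cos_monotone_0_pi_le) auto
    hence "sin x ^ n * cos a \<le> sin x ^ n * cos x"
      using sin_nonneg[OF x] by (intro mult_left_mono) auto
    thus "sin x ^ n \<le> sin x ^ n * cos x / cos a"
      using cospos by (simp add: field_simps)
  qed
  hence "real (Suc n) * integral {0..a} (\<lambda>x. sin x ^ n)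
      \<le> real (Suc n) * (r ^ Suc n / real (Suc n) / cos a)"
    by (intro mult_left_mono) auto
  also have "\<dots> = r ^ Suc n / cos a"
    by (simp del: of_nat_Suc power_Suc)
  finally show "real (Suc n) * integral {0..arcsin r} (\<lambda>x. sin x ^ n) \<le> r ^ Suc n / sqrt (1 - r\<^sup>2)"
    by (simp only: a_def[symmetric] cosa)
qed

text \<open>For d > 1 the factor \<open>w\<close> is exact. For d = 1 it equals 1 / cos (arcsin r)
  \<ge> 1, and the integral bounds put the correction between 1 and \<open>w\<close>. The minimum
  and maximum with 1 cover all d at once.\<close>

lemma \<tau>_bounds:
  assumes "0 < r" "r < 1" "1 \<le> d" "d < D"
  defines "w \<equiv> (1 - r\<^sup>2) powr ((real d - 2) / 2)"
  shows "tau_coeff d D * r ^ (D - d) * min 1 w \<le> \<tau> r d D"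
    and "\<tau> r d D \<le> tau_coeff d D * r ^ (D - d) * max 1 w"
proof -
  have r2: "r\<^sup>2 < 1" using assms by (simp add: power_less_one_iff)
  have B: "tau_coeff d D > 0" using assms tau_coeff_pos by simp
  have "tau_coeff d D * r ^ (D - d) * min 1 w \<le> \<tau> r d D
      \<and> \<tau> r d D \<le> tau_coeff d D * r ^ (D - d) * max 1 w"
  proof (cases "d = 1")
    case False
    hence "\<tau> r d D = tau_coeff d D * r ^ (D - d) * w"
      by (simp add: \<tau>_def tau_coeff_def w_def)
    thus ?thesis using B assms(1) by (auto intro!: mult_left_mono)
  next
    case True
    have "w = 1 / sqrt (1 - r\<^sup>2)"
      using r2 True by (simp add: w_def powr_minus powr_half_sqrt field_simps)
    moreover have "0 < sqrt (1 - r\<^sup>2)" "sqrt (1 - r\<^sup>2) \<le> 1" using r2 by simp_all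
    ultimately have w: "w \<ge> 1" "w = 1 / sqrt (1 - r\<^sup>2)"
      by simp_all
    \<comment> \<open>As D > d = 1 the subtraction is exact, and \<open>Suc n\<close> is the factor
      D - 1 in front of the integral.\<close>
    define n where "n = D - 2"
    have n: "D = n + 2" using assms True by (simp add: n_def)
    define J where "J = real (Suc n) * integral {0..arcsin r} (\<lambda>x. sin x ^ n)"
    have \<tau>: "\<tau> r d D = tau_coeff d D * J"
      using True by (simp add: \<tau>_def tau_coeff_def n J_def add_ac)
    have J: "r ^ (D - d) \<le> J" "J \<le> r ^ (D - d) * w"
      using integral_sin_power_bounds[OF assms(1,2), of n] True w(2) by (simp_all add: n J_def)
    show ?thesis
      using J w(1) B by (simp add: \<tau> mult.assoc min_absorb1 max_absorb2)
  qed
  thus "tau_coeff d D * r ^ (D - d) * min 1 w \<le> \<tau> r d D"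
    and "\<tau> r d D \<le> tau_coeff d D * r ^ (D - d) * max 1 w" by blast+
qed

text \<open>The reciprocal of \<open>\<tau>_us\<close> is \<open>stirling_ratio D\<close> times D
  factors \<open>\<Delta>\<^sub>0 D\<close> / c, with c = \<epsilon> / L. Of these, D - d absorb the
  factors c / n of the radius power, and d remain.\<close>

lemma main_term_eq:
  assumes "\<epsilon> > 0" "L > 0" "d < D" "n > 0"
  shows "B * (\<epsilon> / (L * n)) ^ (D - d) / \<tau>_us D \<epsilon> L x =
    B * stirling_ratio D * (\<Delta>\<^sub>0 D / (\<epsilon> / L)) ^ d * (\<Delta>\<^sub>0 D / n) ^ (D - d)"
proof -
  define c where "c = \<epsilon> / L"
  have c: "c > 0" using assms by (simp add: c_def)
  define k where "k = D - d"
  have D: "D = d + k" using assms by (simp add: k_def)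
  have \<Delta>: "\<Delta>\<^sub>0 D > 0" using assms by (intro \<Delta>\<^sub>0_pos) auto
  have G: "Gamma (real D / 2 + 1) > 0" by (intro Gamma_real_pos) auto
  have pi: "pi powr (real D / 2) = sqrt pi ^ D"
    by (simp add: powr_half_sqrt_powr powr_realpow real_sqrt_power)
  have "B * (c / n) ^ k / (sqrt pi ^ D / (2 ^ D * Gamma (real D / 2 + 1)) * c ^ D) =
    B * (Gamma (real D / 2 + 1) * (2 / (sqrt pi * \<Delta>\<^sub>0 D)) ^ D) * (\<Delta>\<^sub>0 D / c) ^ d * (\<Delta>\<^sub>0 D / n) ^ k"
  proof -
    have "\<Delta>\<^sub>0 D ^ D = \<Delta>\<^sub>0 D ^ d * \<Delta>\<^sub>0 D ^ k" "c ^ D = c ^ d * c ^ k"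
      by (simp_all add: D power_add)
    thus ?thesis using c \<Delta> G assms(4)
      by (simp add: power_divide power_mult_distrib field_simps)
  qed
  moreover have "\<epsilon> / (L * n) = c / n" by (simp add: c_def)
  ultimately show ?thesis
    unfolding stirling_ratio_def \<tau>_us_eq[OF assms(1,2)] pi c_def[symmetric] k_def[symmetric] by simp
qed

text \<open>A point outside \<open>near_opt\<close> exceeds the attained minimum by more than
  \<epsilon>, which the Lipschitz bound converts into distance. This ensures that the radius fed to
  \<open>\<tau>\<close> is below 1.\<close>

lemma Lipschitz_radius_less_edist:
  assumes "L > 0"
    and lipschitz: "\<And>x y. x \<in> cube D \<Longrightarrow> y \<in> cube D \<Longrightarrow> \<bar>f x - f y\<bar> \<le> L * edist D x y"
    and minimizer: "is_arg_min f (\<lambda>x. x \<in> cube D) x"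
    and p: "p \<in> cube D - near_opt D f \<epsilon>"
  shows "\<epsilon> / L < edist D x p"
proof -
  have x: "x \<in> cube D" and le: "\<And>y. y \<in> cube D \<Longrightarrow> f x \<le> f y"
    using minimizer by (auto simp: is_arg_min_linorder)
  have "min_val D f = f x"
    unfolding min_val_def using x le by (intro cInf_eq_minimum) auto
  hence "\<epsilon> < f p - f x" using p by (auto simp: near_opt_def)
  also have "\<dots> \<le> L * edist D x p" using lipschitz[OF x, of p] p by auto
  finally show ?thesis using assms(1) by (simp add: field_simps)
qed

section \<open>Growth or decay of the quotient, decided by the limit of
  \<open>\<rho>\<close>\<close>

theorem theorem4p9:
  fixes \<epsilon> L \<psi> :: real and d :: nat
    and f :: "nat \<Rightarrow> (nat \<Rightarrow> real) \<Rightarrow> real"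
    and xstar p :: "nat \<Rightarrow> nat \<Rightarrow> real"
    and r :: "nat \<Rightarrow> real"
  assumes "\<epsilon> > 0" and "L > 0" and "d \<ge> 1"
    and lipschitz: "\<And>D x y. D > d \<Longrightarrow> x \<in> cube D \<Longrightarrow> y \<in> cube D \<Longrightarrow>
                      \<bar>f D x - f D y\<bar> \<le> L * edist D x y"
    and minimizer: "\<And>D. D > d \<Longrightarrow> is_arg_min (f D) (\<lambda>x. x \<in> cube D) (xstar D)"
    and ball: "\<And>D. D > d \<Longrightarrow> euclid_cball D (\<epsilon> / L) (xstar D) \<subseteq> cube D"
    and p: "\<And>D. D > d \<Longrightarrow> p D \<in> cube D - near_opt D (f D) \<epsilon>"
  defines "r \<equiv> \<lambda>D. \<epsilon> / (L * edist D (xstar D) (p D))"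
  shows "((\<lambda>D. \<Delta>\<^sub>0 D / edist D (xstar D) (p D)) \<longlonglongrightarrow> \<psi> \<and> \<psi> > 1 \<longrightarrow>
            filterlim (\<lambda>D. \<tau> (r D) d D / \<tau>_us D \<epsilon> L (xstar D)) at_top sequentially)
       \<and> ((\<lambda>D. \<Delta>\<^sub>0 D / edist D (xstar D) (p D)) \<longlonglongrightarrow> \<psi> \<and> \<psi> < 1 \<longrightarrow>
            (\<lambda>D. \<tau> (r D) d D / \<tau>_us D \<epsilon> L (xstar D)) \<longlonglongrightarrow> 0)"
proof -
  define n where "n D = edist D (xstar D) (p D)" for D
  define c where "c = \<epsilon> / L"
  define \<rho> where "\<rho> D = \<Delta>\<^sub>0 D / n D" for D
  define \<phi> where "\<phi> D = \<tau> (r D) d D / \<tau>_us D \<epsilon> L (xstar D)" for D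
  define w where "w D = (1 - (r D)\<^sup>2) powr ((real d - 2) / 2)" for D
  \<comment> \<open>\<open>K\<close> gathers what remains beside the geometric factor
    \<open>\<rho> D ^ (D - d)\<close> and the correction by \<open>w\<close>; it lies between
    constant multiples of powers of D.\<close>
  define K where "K D = tau_coeff d D * stirling_ratio D * (\<Delta>\<^sub>0 D / c) ^ d" for D
  have c: "c > 0" using assms(1,2) by (simp add: c_def)
  have n: "n D > c" if "D > d" for D
    unfolding n_def c_def using that assms(2) lipschitz minimizer p
    by (intro Lipschitz_radius_less_edist[where f = "f D"]) auto
  have r_eq: "r D = c / n D" for D by (simp add: r_def c_def n_def)
  have r: "0 < r D" "r D < 1" if "D > d" for D
    using n[OF that] c by (simp_all add: r_eq)
  have \<rho>_pos: "\<rho> D > 0" if "D > d" for D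
    using n[OF that] c that by (simp add: \<rho>_def \<Delta>\<^sub>0_pos)
  have K_pos: "K D > 0" if "D > d" for D
    using that c assms(3) by (simp add: K_def tau_coeff_pos stirling_ratio_pos \<Delta>\<^sub>0_pos)
  have us_pos: "\<tau>_us D \<epsilon> L (xstar D) > 0" for D
    using assms(1,2) by (simp add: \<tau>_us_eq Gamma_real_pos)
  \<comment> \<open>The free factor \<open>y\<close> serves for both corrections,
    \<open>min 1 (w D)\<close> and \<open>max 1 (w D)\<close>.\<close>
  have main: "tau_coeff d D * r D ^ (D - d) * y / \<tau>_us D \<epsilon> L (xstar D) = K D * \<rho> D ^ (D - d) * y"
    if "D > d" for D y
    using main_term_eq[OF assms(1,2) that, of "n D" "tau_coeff d D * y" "xstar D"] n[OF that] c
    by (simp add: K_def \<rho>_def r_def n_def c_def mult_ac)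
  have \<phi>_lower: "K D * \<rho> D ^ (D - d) * min 1 (w D) \<le> \<phi> D"
    and \<phi>_upper: "\<phi> D \<le> K D * \<rho> D ^ (D - d) * max 1 (w D)" if "D > d" for D
    using divide_right_mono[OF \<tau>_bounds(1)[OF r[OF that] assms(3) that] less_imp_le[OF us_pos[of D]]]
      divide_right_mono[OF \<tau>_bounds(2)[OF r[OF that] assms(3) that] less_imp_le[OF us_pos[of D]]]
    by (simp_all add: main[OF that] \<phi>_def flip: w_def)

  have w_lim: "w \<longlonglongrightarrow> 1" if \<rho>: "\<rho> \<longlonglongrightarrow> \<psi>"
  proof -
    have "(\<lambda>D. c * \<rho> D / \<Delta>\<^sub>0 D) \<longlonglongrightarrow> 0"
      by (intro tendsto_divide_0[OF tendsto_mult[OF tendsto_const \<rho>]]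
          filterlim_at_top_imp_at_infinity \<Delta>\<^sub>0_at_top)
    moreover have "\<forall>\<^sub>F D in sequentially. c * \<rho> D / \<Delta>\<^sub>0 D = r D"
      using eventually_gt_at_top[of d]
    proof eventually_elim
      case (elim D)
      thus ?case using \<Delta>\<^sub>0_pos[of D] by (simp add: r_eq \<rho>_def)
    qed
    ultimately have "r \<longlonglongrightarrow> 0" by (rule Lim_transform_eventually)
    hence "(\<lambda>D. (1 - (r D)\<^sup>2) powr ((real d - 2) / 2)) \<longlonglongrightarrow> (1 - 0\<^sup>2) powr ((real d - 2) / 2)"
      by (intro tendsto_intros) auto
    thus ?thesis by (simp add: w_def[abs_def])
  qed

  have part_a: "filterlim \<phi> at_top sequentially" if \<rho>: "\<rho> \<longlonglongrightarrow> \<psi>" and \<psi>: "\<psi> > 1"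
  proof -
    \<comment> \<open>Eventually \<open>\<rho> D\<close> exceeds \<open>q\<close>, and q^D with q >
      1 outgrows the loss of a factor D in the lower bound.\<close>
    obtain q where q: "1 < q" "q < \<psi>" using dense[OF \<psi>] by blast
    obtain m where m: "m > 0" "\<And>D. D > d \<Longrightarrow> m / real D \<le> tau_coeff d D * stirling_ratio D"
      using polynomial_lower_bound[OF assms(3)] by blast
    \<comment> \<open>The 2 comes from \<open>w D > 1 / 2\<close>, the q^d from splitting
      \<open>q ^ (D - d)\<close>, and \<epsilon> / L enters through
      \<open>\<Delta>\<^sub>0 1 \<le> \<Delta>\<^sub>0 D\<close>.\<close>
    define m' where "m' = m * (\<Delta>\<^sub>0 1 / c) ^ d / q ^ d / 2"
    have m': "m' > 0" using m(1) c q by (simp add: m'_def \<Delta>\<^sub>0_pos)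
    have "filterlim (\<lambda>D. q ^ D / real D) at_top sequentially"
      using q(1) by real_asymp
    hence lim: "filterlim (\<lambda>D. m' * (q ^ D / real D)) at_top sequentially"
      by (rule filterlim_tendsto_pos_mult_at_top[OF tendsto_const m'])
    have "\<forall>\<^sub>F D in sequentially. w D > 1 / 2"
      using w_lim[OF \<rho>] by (rule order_tendstoD) simp
    moreover have "\<forall>\<^sub>F D in sequentially. \<rho> D > q"
      using \<rho> q(2) by (rule order_tendstoD)
    ultimately have "\<forall>\<^sub>F D in sequentially. m' * (q ^ D / real D) \<le> \<phi> D"
      using eventually_gt_at_top[of d]
    proof eventually_elim
      case (elim D)
      have "\<Delta>\<^sub>0 1 \<le> \<Delta>\<^sub>0 D"
        using elim by (simp add: \<Delta>\<^sub>0_eq[of D] \<Delta>\<^sub>0_pos)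
      hence "m / real D * (\<Delta>\<^sub>0 1 / c) ^ d \<le> K D"
        unfolding K_def using m(1) m(2)[OF elim(3)] c \<Delta>\<^sub>0_pos[of 1] elim(3)
          tau_coeff_pos[OF assms(3) elim(3)] stirling_ratio_pos[of D]
        by (intro mult_mono power_mono divide_right_mono) auto
      hence "m / real D * (\<Delta>\<^sub>0 1 / c) ^ d * q ^ (D - d) * (1 / 2)
          \<le> K D * \<rho> D ^ (D - d) * min 1 (w D)"
        using elim q(1) K_pos[OF elim(3)] \<rho>_pos[OF elim(3)]
        by (intro mult_mono power_mono mult_nonneg_nonneg) auto
      also have "\<dots> \<le> \<phi> D" by (rule \<phi>_lower[OF elim(3)])
      finally show ?case
        using elim(3) q(1) by (simp add: m'_def power_diff field_simps)
    qed
    thus ?thesis by (rule filterlim_at_top_mono[OF lim])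
  qed

  have part_b: "\<phi> \<longlonglongrightarrow> 0" if \<rho>: "\<rho> \<longlonglongrightarrow> \<psi>" and \<psi>: "\<psi> < 1"
  proof -
    \<comment> \<open>Choosing \<open>q\<close> above this maximum secures q > 0 as well as q >
      \<psi>.\<close>
    have "max 0 \<psi> < 1" using \<psi> by simp
    then obtain q where q: "0 < q" "\<psi> < q" "q < 1" using dense by (metis max_less_iff_conj)
    obtain M where M: "M > 0" "\<And>D. D > d \<Longrightarrow> tau_coeff d D * stirling_ratio D \<le> M * real D ^ (d + 1)"
      using polynomial_upper_bound[OF assms(3)] by blast
    define M' where "M' = 2 * M * (\<Delta>\<^sub>0 1 / c) ^ d / q ^ d"
    have "(\<lambda>D. real D ^ (2 * d + 1) * q ^ D) \<longlonglongrightarrow> 0"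
      using q(1,3) by real_asymp
    hence lim: "(\<lambda>D. M' * (real D ^ (2 * d + 1) * q ^ D)) \<longlonglongrightarrow> 0"
      by (rule tendsto_mult_right_zero)
    have "\<forall>\<^sub>F D in sequentially. w D < 2"
      using w_lim[OF \<rho>] by (rule order_tendstoD) simp
    moreover have "\<forall>\<^sub>F D in sequentially. \<rho> D < q"
      using \<rho> q(2) by (rule order_tendstoD)
    ultimately have upper: "\<forall>\<^sub>F D in sequentially. \<phi> D \<le> M' * (real D ^ (2 * d + 1) * q ^ D)"
      using eventually_gt_at_top[of d]
    proof eventually_elim
      case (elim D)
      \<comment> \<open>The crude sqrt D \<le> D replaces half-integer powers: d further factors D
        join D^(d + 1), giving the exponent 2 * d + 1.\<close>
      have "real D \<le> (real D)\<^sup>2" using elim(3) by (simp add: power2_eq_square)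
      hence "sqrt (real D) \<le> real D" by (simp add: real_le_lsqrt)
      hence "\<Delta>\<^sub>0 D \<le> \<Delta>\<^sub>0 1 * real D"
        by (simp add: \<Delta>\<^sub>0_eq[of D] \<Delta>\<^sub>0_pos)
      hence "(\<Delta>\<^sub>0 D / c) ^ d \<le> (\<Delta>\<^sub>0 1 * real D / c) ^ d"
        using c \<Delta>\<^sub>0_pos[of D] elim(3) by (intro power_mono divide_right_mono) auto
      hence "K D \<le> M * real D ^ (d + 1) * (\<Delta>\<^sub>0 1 * real D / c) ^ d"
        unfolding K_def by (rule mult_mono[OF M(2)[OF elim(3)]])
          (use M(1) c \<Delta>\<^sub>0_pos[of D] elim(3) in auto)
      hence "K D * \<rho> D ^ (D - d) * max 1 (w D)
          \<le> M * real D ^ (d + 1) * (\<Delta>\<^sub>0 1 * real D / c) ^ d * q ^ (D - d) * 2"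
        using elim q(1) K_pos[OF elim(3)] \<rho>_pos[OF elim(3)] M(1) c \<Delta>\<^sub>0_pos[of 1]
        by (intro mult_mono power_mono mult_nonneg_nonneg) auto
      also have "\<dots> = M' * (real D ^ (2 * d + 1) * q ^ D)"
      proof -
        have "(\<Delta>\<^sub>0 1 * real D / c) ^ d = (\<Delta>\<^sub>0 1 / c) ^ d * real D ^ d"
          by (simp add: power_mult_distrib power_divide)
        moreover have "real D ^ (2 * d + 1) = real D ^ (d + 1) * real D ^ d"
          by (simp add: mult_2 power_add)
        moreover have "q ^ (D - d) = q ^ D / q ^ d"
          using elim(3) q(1) by (intro power_diff) auto
        ultimately show ?thesis
          unfolding M'_def by (simp only:) (simp only: mult_ac times_divide_eq_left times_divide_eq_right)
      qed
      finally show ?case using \<phi>_upper[OF elim(3)] by linarith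
    qed
    \<comment> \<open>Nonnegativity provides the lower side of the sandwich.\<close>
    have "\<forall>\<^sub>F D in sequentially. 0 \<le> \<phi> D"
      using eventually_gt_at_top[of d]
    proof eventually_elim
      case (elim D)
      have "0 \<le> K D * \<rho> D ^ (D - d) * min 1 (w D)"
        using K_pos[OF elim] \<rho>_pos[OF elim] by (intro mult_nonneg_nonneg) (auto simp: w_def)
      thus ?case using \<phi>_lower[OF elim] by linarith
    qed
    thus ?thesis by (rule tendsto_sandwich[OF _ upper tendsto_const lim])
  qed
  show ?thesis
    using part_a part_b unfolding \<phi>_def[abs_def] \<rho>_def[abs_def] n_def[abs_def] by blast
qed

end
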